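(* Let $N \ge 1$ be an integer, $1 \le p < +\infty$, and $-1 < \gamma < 0$. Then $\Phi_\lambda$ $\Gamma$-converges to $0$ in $L^p(\mathbb{R}^N)$ as $\lambda \to 0_+$.
   Context: Functions are real-valued. For $u \in L^p(\mathbb{R}^N)$ and $\lambda>0$, and for the given $p$ and $\gamma$, $$\Phi_\lambda(u) = \lambda^p \iint_{\{(x,y)\in \mathbb{R}^N\times\mathbb{R}^N:\ |u(x)-u(y)|/|x-y|^{1+\gamma/p} > \lambda\}} |x-y|^{-N+\gamma}\,dx\,dy \in [0,+\infty].$$ A family of functionals $F_\lambda : L^p(\mathbb{R}^N) \to [0,+\infty]$ $\Gamma$-converges to $F$ in $L^p(\mathbb{R}^N)$ as $\lambda \to 0_+$ if for every $u \in L^p(\mathbb{R}^N)$: (i) there exists a family $(u_\lambda)$ with $u_\lambda \to u$ in $L^p(\mathbb{R}^N)$ as $\lambda\to 0_+$ and $\limsup_{\lambda \to 0_+} F_\lambda(u_\lambda) \le F(u)$; and (ii) for every family $(u_\lambda)$ with $u_\lambda \to u$ in $L^p(\mathbb{R}^N)$ as $\lambda \to 0_+$, $\liminf_{\lambda \to 0_+} F_\lambda(u_\lambda) \ge F(u)$. *)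

theory Defs
  imports "HOL-Analysis.Analysis"
begin

(* L^p is modelled by its representatives: Lebesgue measurable functions, not identified when they
   agree almost everywhere.  Convergence in L^p is then with respect to a seminorm. *)
definition Lp :: "real \<Rightarrow> (real ^ 'n \<Rightarrow> real) set" where
  "Lp p = {u \<in> borel_measurable lebesgue. integrable lebesgue (\<lambda>x. \<bar>u x\<bar> powr p)}"

definition Lp_norm :: "real \<Rightarrow> (real ^ 'n \<Rightarrow> real) \<Rightarrow> real" where
  "Lp_norm p u = (integral\<^sup>L lebesgue (\<lambda>x. \<bar>u x\<bar> powr p)) powr (1 / p)"

definition Lp_tendsto ::
  "real \<Rightarrow> (real \<Rightarrow> real ^ 'n \<Rightarrow> real) \<Rightarrow> (real ^ 'n \<Rightarrow> real) \<Rightarrow> bool" where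
  "Lp_tendsto p w u \<longleftrightarrow>
     ((\<lambda>l. Lp_norm p (\<lambda>x. w l x - u x)) \<longlongrightarrow> 0) (at_right 0)"

(* The diagonal x = y is not in this set, since 0 / 0 = 0 in HOL; it is a null set anyway. *)
definition Phi_set ::
  "real \<Rightarrow> real \<Rightarrow> real \<Rightarrow> (real ^ 'n \<Rightarrow> real) \<Rightarrow> ((real ^ 'n) \<times> (real ^ 'n)) set" where
  "Phi_set p \<gamma> l u = {(x, y). \<bar>u x - u y\<bar> / norm (x - y) powr (1 + \<gamma> / p) > l}"

definition Phi :: "real \<Rightarrow> real \<Rightarrow> real \<Rightarrow> (real ^ 'n \<Rightarrow> real) \<Rightarrow> ennreal" where
  "Phi p \<gamma> l u = ennreal (l powr p) *
     (\<integral>\<^sup>+ z \<in> Phi_set p \<gamma> l u.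
        ennreal (norm (fst z - snd z) powr (- real CARD('n) + \<gamma>)) \<partial>(lebesgue \<Otimes>\<^sub>M lebesgue))"

(* Families are functions of a real parameter l of which only the values at l > 0 matter. *)
definition Gamma_converges_Lp ::
  "real \<Rightarrow> (real \<Rightarrow> (real ^ 'n \<Rightarrow> real) \<Rightarrow> ennreal) \<Rightarrow> ((real ^ 'n \<Rightarrow> real) \<Rightarrow> ennreal) \<Rightarrow> bool" where
  "Gamma_converges_Lp p F G \<longleftrightarrow> (\<forall>u \<in> Lp p.
     (\<exists>w. (\<forall>l>0. w l \<in> Lp p) \<and> Lp_tendsto p w u \<and>
          Limsup (at_right 0) (\<lambda>l. F l (w l)) \<le> G u) \<and>
     (\<forall>w. (\<forall>l>0. w l \<in> Lp p) \<and> Lp_tendsto p w u \<longrightarrow>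
          Liminf (at_right 0) (\<lambda>l. F l (w l)) \<ge> G u))"

end

theory Submission
  imports Defs
begin

text \<open>
  The set defining \<open>\<Phi>\<^sub>\<lambda>(g)\<close> lies in \<open>{g(x) \<noteq> g(y)}\<close>, so
  \<open>\<Phi>\<^sub>\<lambda>(g) \<le> \<lambda>\<^sup>p J(g)\<close> with \<open>J(g)\<close> the integral of the kernel over \<open>{g(x) \<noteq> g(y)}\<close>.  For the indicator
  of a ball \<open>J\<close> is a fractional perimeter of order \<open>-\<gamma> < 1\<close>, hence finite, and \<open>J(g) < \<infinity>\<close> is preserved by
  linear combinations and unions.  Such functions are dense in \<open>L\<^sup>p\<close>, and for each of them
  \<open>\<Phi>\<^sub>\<lambda>(g) \<rightarrow> 0\<close>.  A near-minimizer of \<open>\<parallel>f - u\<parallel>\<^sub>p + \<Phi>\<^sub>\<lambda>(f)\<close> is then a recovery family for \<open>u\<close>;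
  the lower bound is trivial.
\<close>

section \<open>Measure theory on the product of two completed Lebesgue measures\<close>

text \<open>Closed balls of natural radius exhaust the space. The point is to have Tonelli's theorem
  for the completed measure, since \<open>Phi\<close> integrates over a product of two copies of
  it.\<close>

lemma sigma_finite_lebesgue: "sigma_finite_measure (lebesgue :: 'a::euclidean_space measure)"
proof
  show "\<exists>A. countable A \<and> A \<subseteq> sets (lebesgue :: 'a measure) \<and> \<Union>A = space lebesgue \<and>
      (\<forall>a\<in>A. emeasure lebesgue a \<noteq> \<infinity>)"
  proof (intro exI conjI ballI)
    show "\<Union>(range (\<lambda>n::nat. cball (0::'a) (real n))) = space lebesgue"
      by (auto simp: real_arch_simple)
  qed (auto simp: less_imp_neq[OF emeasure_lborel_cball_finite, simplified])
qed

interpretation lebesgue: sigma_finite_measure "lebesgue :: 'a::euclidean_space measure"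
  by (rule sigma_finite_lebesgue)

interpretation lebesgue_pair: pair_sigma_finite "lebesgue :: 'a::euclidean_space measure"
    "lebesgue :: 'b::euclidean_space measure" ..

lemma measurable_lebesgue_borel [measurable]: "(\<lambda>x. x) \<in> lebesgue \<rightarrow>\<^sub>M borel"
  by (simp add: measurable_completion)

text \<open>The kernel is a Borel function of the two coordinates; these rules let the measurability
  prover see it as measurable on a product of completed measures.\<close>

lemma measurable_lebesgue_pair_borel [measurable]:
  "fst \<in> lebesgue \<Otimes>\<^sub>M M \<rightarrow>\<^sub>M borel" "snd \<in> M \<Otimes>\<^sub>M lebesgue \<rightarrow>\<^sub>M borel"
  by (rule measurable_compose[OF measurable_fst measurable_lebesgue_borel]
      measurable_compose[OF measurable_snd measurable_lebesgue_borel])+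

section \<open>Finite jump energy of balls\<close>

text \<open>For the indicator of a set E and \<open>s = N + \<sigma>\<close> this is twice the
  fractional \<sigma>-perimeter of E: each pair with one point in E and one outside is counted in
  both orders.\<close>

definition jump_energy :: "real \<Rightarrow> ('a::euclidean_space \<Rightarrow> real) \<Rightarrow> ennreal" where
  "jump_energy s f = (\<integral>\<^sup>+z. indicator {(x, y). f x \<noteq> f y} z * ennreal (norm (fst z - snd z) powr - s)
     \<partial>(lebesgue \<Otimes>\<^sub>M lebesgue))"

text \<open>For \<open>r \<le> R\<close>, Bernoulli's inequality gives 1 - (1 - r/R)^N \<le> N r/R.
  For \<open>r > R\<close> the inner ball is empty and the minimum is 1 because N \<ge> 1. The
  linear decay as r tends to 0 is what later tames the singularity of the kernel.\<close>

lemma emeasure_lebesgue_annulus_le: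
  fixes c :: "'a::euclidean_space" and r R :: real
  assumes R: "0 < R" and r: "0 \<le> r"
  shows "emeasure lebesgue (ball c R - ball c (R - r)) \<le>
    ennreal (unit_ball_vol (DIM('a)) * R ^ DIM('a) * min 1 (DIM('a) * r / R))"
proof (cases "r \<le> R")
  case True
  define N where "N = DIM('a)"
  have "emeasure lebesgue (ball c R - ball c (R - r)) = emeasure lborel (ball c R - ball c (R - r))"
    by simp
  also have "\<dots> = emeasure lborel (ball c R) - emeasure lborel (ball c (R - r))"
    using True r by (intro emeasure_Diff) (auto simp: emeasure_ball)
  also have "\<dots> = ennreal (unit_ball_vol N * R ^ N - unit_ball_vol N * (R - r) ^ N)"
    using True r R by (simp add: emeasure_ball ennreal_minus N_def)
  also have "\<dots> = ennreal (unit_ball_vol N * R ^ N * (1 - (1 - r / R) ^ N))"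
    using R by (simp add: right_diff_distrib power_mult_distrib[symmetric] mult.assoc)
  also have "\<dots> \<le> ennreal (unit_ball_vol N * R ^ N * min 1 (N * r / R))"
  proof (intro ennreal_leI mult_left_mono)
    have "1 + real N * (- (r / R)) \<le> (1 + - (r / R)) ^ N"
      using True R by (intro Bernoulli_inequality) (simp add: field_simps)
    then show "1 - (1 - r / R) ^ N \<le> min 1 (N * r / R)"
      using True R by (simp add: field_simps)
  qed (use R in auto)
  finally show ?thesis by (simp add: N_def)
next
  case False
  have "emeasure lebesgue (ball c R - ball c (R - r)) \<le> emeasure lebesgue (ball c R)"
    by (intro emeasure_mono) auto
  also have "\<dots> = ennreal (unit_ball_vol (DIM('a)) * R ^ DIM('a))"
    using R by (simp add: emeasure_ball)
  also have "min 1 (DIM('a) * r / R) = 1"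
  proof -
    have "R * 1 \<le> r * real DIM('a)"
      using False R by (intro mult_mono) (auto simp: DIM_positive Suc_leI)
    then show ?thesis using R by (simp add: min_def field_simps)
  qed
  then have "ennreal (unit_ball_vol (DIM('a)) * R ^ DIM('a)) =
      ennreal (unit_ball_vol (DIM('a)) * R ^ DIM('a) * min 1 (DIM('a) * r / R))"
    by simp
  finally show ?thesis .
qed

lemma nn_integral_powr_atLeast:
  fixes a s :: real
  assumes "0 < a" "0 < s"
  shows "(\<integral>\<^sup>+r. ennreal (r powr (- s - 1)) * indicator {a..} r \<partial>lborel) = ennreal (a powr - s / s)"
  using nn_integral_has_integral_lebesgue'[OF _ has_integral_powr_to_inf[of "- s - 1" a]] assms
  by simp

text \<open>Below 1 the minimum contributes a factor r, leaving \<open>r powr - \<sigma>\<close>,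
  integrable at 0 since \<sigma> < 1; above 1 the bound 1 leaves
  \<open>r powr (- \<sigma> - 1)\<close>, integrable at infinity since \<sigma> > 0. With \<sigma> =
  -\<gamma>, this is where the range of \<gamma> matters.\<close>

lemma nn_integral_layer_finite:
  fixes \<sigma> C D :: real
  assumes "0 < \<sigma>" "\<sigma> < 1" "0 \<le> C" "0 \<le> D"
  shows "(\<integral>\<^sup>+r. ennreal (r powr (- \<sigma> - 1) * (C * min 1 (D * r))) * indicator {0..} r \<partial>lborel) < \<infinity>"
proof -
  have "(\<integral>\<^sup>+r. ennreal (r powr (- \<sigma> - 1) * (C * min 1 (D * r))) * indicator {0..} r \<partial>lborel) \<le>
    (\<integral>\<^sup>+r. ennreal (C * D) * (ennreal (r powr - \<sigma>) * indicator {0..1} r) +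
        ennreal C * (ennreal (r powr (- \<sigma> - 1)) * indicator {1..} r) \<partial>lborel)"
  proof (intro nn_integral_mono)
    fix r :: real
    show "ennreal (r powr (- \<sigma> - 1) * (C * min 1 (D * r))) * indicator {0..} r \<le>
      ennreal (C * D) * (ennreal (r powr - \<sigma>) * indicator {0..1} r) +
        ennreal C * (ennreal (r powr (- \<sigma> - 1)) * indicator {1..} r)"
    proof (cases "0 < r \<and> r < 1")
      case True
      have "r powr (- \<sigma> - 1) * r = r powr - \<sigma>"
        using True by (simp add: powr_diff)
      then have "r powr (- \<sigma> - 1) * (C * (D * r)) = C * D * r powr - \<sigma>"
        by (simp add: algebra_simps)
      moreover have "r powr (- \<sigma> - 1) * (C * min 1 (D * r)) \<le> r powr (- \<sigma> - 1) * (C * (D * r))"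
        using assms by (intro mult_left_mono) auto
      ultimately have "r powr (- \<sigma> - 1) * (C * min 1 (D * r)) \<le> C * D * r powr - \<sigma>"
        by metis
      then show ?thesis
        using True assms by (simp add: ennreal_mult[symmetric] ennreal_leI)
    next
      case False
      have "r powr (- \<sigma> - 1) * (C * min 1 (D * r)) \<le> r powr (- \<sigma> - 1) * (C * 1)"
        using assms by (intro mult_left_mono) auto
      then have "ennreal (r powr (- \<sigma> - 1) * (C * min 1 (D * r))) \<le> ennreal C * ennreal (r powr (- \<sigma> - 1))"
        using assms by (simp add: ennreal_mult[symmetric] ennreal_leI mult.commute)
      then show ?thesis
        \<comment> \<open>At \<open>r = 0\<close> the left side vanishes because
          \<open>0 powr a = 0\<close>; for negative r its indicator vanishes. Only
          \<open>r \<ge> 1\<close> needs the estimate.\<close>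
        using False by (cases "r < 0 \<or> r = 0") (auto simp: add_increasing)
    qed
  qed
  also have "\<dots> = ennreal (C * D) * (\<integral>\<^sup>+r. ennreal (r powr - \<sigma>) * indicator {0..1} r \<partial>lborel) +
      ennreal C * (\<integral>\<^sup>+r. ennreal (r powr (- \<sigma> - 1)) * indicator {1..} r \<partial>lborel)"
    by (simp add: nn_integral_add nn_integral_cmult)
  also have "\<dots> < \<infinity>"
    using nn_integral_has_integral_lebesgue'[OF _ has_integral_powr_from_0[of "- \<sigma>" 1]]
      nn_integral_powr_atLeast[of 1 \<sigma>] assms
    by (simp add: ennreal_mult_less_top)
  finally show ?thesis .
qed

text \<open>After the kernel is spread over radii r, the y-integral contributes r^N and the
  x-integral the volume of an annulus of width r. The factor r^N turns the weight
  \<open>r powr (- s - 1)\<close> into \<open>r powr (- \<sigma> - 1)\<close>, so the layer integral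
  above decides finiteness.\<close>

lemma jump_energy_ball:
  fixes c :: "'a::euclidean_space" and \<sigma> R :: real
  assumes \<sigma>: "0 < \<sigma>" "\<sigma> < 1" and R: "0 < R"
  shows "jump_energy (DIM('a) + \<sigma>) (indicator (ball c R)) < \<infinity>"
proof -
  define s where "s = DIM('a) + \<sigma>"
  let ?L = "lebesgue :: 'a measure"
  interpret P: sigma_finite_measure "?L \<Otimes>\<^sub>M ?L"
    by (rule lebesgue_pair.sigma_finite_measure_axioms)
  interpret PR: pair_sigma_finite "?L \<Otimes>\<^sub>M ?L" "lborel :: real measure" ..
  have s: "0 < s" using \<sigma> by (simp add: s_def)
  define B where "B = ball c R"
  have [measurable]: "B \<in> sets lebesgue" by (simp add: B_def)
  define k where "k z = ennreal (norm (fst z - snd z) powr - s)" for z :: "'a \<times> 'a"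
  have [measurable]: "k \<in> borel_measurable (?L \<Otimes>\<^sub>M ?L)"
    unfolding k_def by measurable
  define h where "h z = indicator B (fst z) * indicator (- B) (snd z) * k z" for z :: "'a \<times> 'a"
  have [measurable]: "h \<in> borel_measurable (?L \<Otimes>\<^sub>M ?L)"
    unfolding h_def by measurable
  \<comment> \<open>For x in B and y outside B, \<open>T (x, y) r\<close> just says |x - y| \<le> r.
    In general it constrains y only by its distance to x, which makes the y-integral below the
    volume of a full ball.\<close>
  define T where "T z r = (norm (fst z - snd z) \<le> r \<and> fst z \<in> B \<and> fst z \<notin> ball c (R - r))"
    for z :: "'a \<times> 'a" and r :: real
  have T: "(\<lambda>w. indicator {w. T (fst w) (snd w)} w :: ennreal) \<in> borel_measurable ((?L \<Otimes>\<^sub>M ?L) \<Otimes>\<^sub>M lborel)"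
    unfolding T_def ball_def mem_Collect_eq B_def by measurable
  define W where "W = unit_ball_vol (real DIM('a))"
  \<comment> \<open>Tonelli in both orders of integration yields the invariance under exchanging the
    coordinates.\<close>
  have swap: "(\<integral>\<^sup>+z. h (prod.swap z) \<partial>(?L \<Otimes>\<^sub>M ?L)) = (\<integral>\<^sup>+z. h z \<partial>(?L \<Otimes>\<^sub>M ?L))"
  proof -
    have "(\<integral>\<^sup>+z. h (prod.swap z) \<partial>(?L \<Otimes>\<^sub>M ?L)) = (\<integral>\<^sup>+x. \<integral>\<^sup>+y. h (prod.swap (x, y)) \<partial>?L \<partial>?L)"
      by (subst lebesgue.nn_integral_fst[symmetric]) (auto simp: prod.swap_def)
    also have "\<dots> = (\<integral>\<^sup>+z. h z \<partial>(?L \<Otimes>\<^sub>M ?L))"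
      by (subst lebesgue_pair.nn_integral_snd[symmetric]) auto
    finally show ?thesis .
  qed
  have "jump_energy s (indicator B) = (\<integral>\<^sup>+z. h z + h (prod.swap z) \<partial>(?L \<Otimes>\<^sub>M ?L))"
    unfolding jump_energy_def
    by (intro nn_integral_cong) (auto simp: h_def k_def indicator_def norm_minus_commute)
  also have "\<dots> = 2 * (\<integral>\<^sup>+z. h z \<partial>(?L \<Otimes>\<^sub>M ?L))"
    by (subst nn_integral_add) (auto simp: prod.swap_def swap[unfolded prod.swap_def] mult_2)
  also have "(\<integral>\<^sup>+z. h z \<partial>(?L \<Otimes>\<^sub>M ?L)) < \<infinity>"
  proof -
    \<comment> \<open>Layer cake: \<open>t\<^sup>-\<^sup>s = s \<integral> r\<^sup>-\<^sup>s\<^sup>-\<^sup>1 dr\<close> over \<open>r \<ge> t = |x - y|\<close>; points of the ball within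
       distance \<open>r\<close> of the complement lie in an annulus of width \<open>r\<close>.\<close>
    have "(\<integral>\<^sup>+z. h z \<partial>(?L \<Otimes>\<^sub>M ?L)) \<le>
      (\<integral>\<^sup>+z. \<integral>\<^sup>+r. ennreal (s * r powr (- s - 1)) * indicator {w. T (fst w) (snd w)} (z, r) \<partial>lborel \<partial>(?L \<Otimes>\<^sub>M ?L))"
    proof (intro nn_integral_mono)
      fix z :: "'a \<times> 'a"
      obtain x y where z: "z = (x, y)" by (cases z)
      show "h z \<le> (\<integral>\<^sup>+r. ennreal (s * r powr (- s - 1)) * indicator {w. T (fst w) (snd w)} (z, r) \<partial>lborel)"
      proof (cases "x \<in> B \<and> y \<notin> B")
        case True
        then have ne: "norm (x - y) > 0" by auto
        have "h z = ennreal s * ennreal (norm (x - y) powr - s / s)"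
          using True s by (simp add: h_def k_def z ennreal_mult[symmetric])
        also have "\<dots> = ennreal s * (\<integral>\<^sup>+r. ennreal (r powr (- s - 1)) * indicator {norm (x - y)..} r \<partial>lborel)"
          by (subst nn_integral_powr_atLeast[OF ne s]) simp
        also have "\<dots> = (\<integral>\<^sup>+r. ennreal s * (ennreal (r powr (- s - 1)) * indicator {norm (x - y)..} r) \<partial>lborel)"
          by (rule nn_integral_cmult[symmetric]) simp
        also have "\<dots> = (\<integral>\<^sup>+r. ennreal (s * r powr (- s - 1)) * indicator {w. T (fst w) (snd w)} (z, r) \<partial>lborel)"
        proof (intro nn_integral_cong)
          fix r :: real
          have "T z r" if "norm (x - y) \<le> r"
          proof -
            have "dist c y \<le> dist c x + norm (x - y)"
              using dist_triangle[of c y x] by (simp add: dist_norm norm_minus_commute)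
            then show ?thesis
              using that True by (auto simp: T_def z B_def)
          qed
          moreover have "norm (x - y) \<le> r" if "T z r" using that by (simp add: T_def z)
          ultimately show "ennreal s * (ennreal (r powr (- s - 1)) * indicator {norm (x - y)..} r) =
              ennreal (s * r powr (- s - 1)) * indicator {w. T (fst w) (snd w)} (z, r)"
            using s by (auto simp: indicator_def ennreal_mult)
        qed
        finally show ?thesis by simp
      qed (auto simp: h_def z)
    qed
    also have "\<dots> = (\<integral>\<^sup>+r. \<integral>\<^sup>+z. ennreal (s * r powr (- s - 1)) * indicator {w. T (fst w) (snd w)} (z, r) \<partial>(?L \<Otimes>\<^sub>M ?L) \<partial>lborel)"
      by (rule PR.Fubini'[symmetric]) (use T in \<open>simp add: split_beta'\<close>)
    also have "\<dots> \<le> (\<integral>\<^sup>+r. ennreal (s * W) * (ennreal (r powr (- \<sigma> - 1) * ((W * R ^ DIM('a)) * min 1 (DIM('a) / R * r))) * indicator {0..} r) \<partial>lborel)"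
    proof (intro nn_integral_mono)
      fix r :: real
      show "(\<integral>\<^sup>+z. ennreal (s * r powr (- s - 1)) * indicator {w. T (fst w) (snd w)} (z, r) \<partial>(?L \<Otimes>\<^sub>M ?L)) \<le>
        ennreal (s * W) * (ennreal (r powr (- \<sigma> - 1) * ((W * R ^ DIM('a)) * min 1 (DIM('a) / R * r))) * indicator {0..} r)"
      proof (cases "0 < r")
        case True
        \<comment> \<open>For fixed r the indicator of T factorizes into the annulus condition on x
          and a ball around x for y.\<close>
        have Tr: "indicator {w. T (fst w) (snd w)} ((x, y), r) =
            (indicator (ball c R - ball c (R - r)) x * indicator (cball x r) y :: ennreal)" for x y
          by (auto simp: T_def indicator_def B_def dist_norm)
        have [measurable]: "(\<lambda>z. indicator {w. T (fst w) (snd w)} (z, r) :: ennreal) \<in> borel_measurable (?L \<Otimes>\<^sub>M ?L)"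
          using T by (rule measurable_compose[rotated]) simp
        have "(\<integral>\<^sup>+z. indicator {w. T (fst w) (snd w)} (z, r) \<partial>(?L \<Otimes>\<^sub>M ?L)) =
            (\<integral>\<^sup>+x. \<integral>\<^sup>+y. indicator (ball c R - ball c (R - r)) x * indicator (cball x r) y \<partial>?L \<partial>?L)"
          by (subst lebesgue.nn_integral_fst[symmetric]) (auto simp: Tr)
        also have "\<dots> = (\<integral>\<^sup>+x. indicator (ball c R - ball c (R - r)) x * ennreal (W * r ^ DIM('a)) \<partial>?L)"
          using True by (simp add: nn_integral_cmult_indicator emeasure_cball W_def)
        also have "\<dots> = emeasure lebesgue (ball c R - ball c (R - r)) * ennreal (W * r ^ DIM('a))"
          by (subst nn_integral_multc) (auto intro!: borel_measurable_indicator)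
        also have "\<dots> \<le> ennreal (W * R ^ DIM('a) * min 1 (DIM('a) * r / R)) * ennreal (W * r ^ DIM('a))"
          unfolding W_def using True by (intro mult_right_mono emeasure_lebesgue_annulus_le R) auto
        finally have 1: "(\<integral>\<^sup>+z. indicator {w. T (fst w) (snd w)} (z, r) \<partial>(?L \<Otimes>\<^sub>M ?L)) \<le>
           ennreal (W * R ^ DIM('a) * min 1 (DIM('a) * r / R)) * ennreal (W * r ^ DIM('a))" .
        have W: "0 \<le> W" by (simp add: W_def)
        have "(\<integral>\<^sup>+z. ennreal (s * r powr (- s - 1)) * indicator {w. T (fst w) (snd w)} (z, r) \<partial>(?L \<Otimes>\<^sub>M ?L)) \<le>
          ennreal (s * r powr (- s - 1)) * (ennreal (W * R ^ DIM('a) * min 1 (DIM('a) * r / R)) * ennreal (W * r ^ DIM('a)))"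
          by (subst nn_integral_cmult) (auto intro!: mult_left_mono 1)
        also have "\<dots> = ennreal (s * r powr (- s - 1) * (W * R ^ DIM('a) * min 1 (DIM('a) * r / R) * (W * r ^ DIM('a))))"
          using s W R True by (simp add: ennreal_mult)
        \<comment> \<open>Here the dimension cancels: \<open>s = N + \<sigma>\<close>, and r^N is
          the volume factor from the y-integral.\<close>
        also have "r powr (- \<sigma> - 1) = r powr (- s - 1) * r ^ DIM('a)"
          using True by (simp add: s_def powr_realpow[symmetric] powr_add[symmetric])
        then have "s * r powr (- s - 1) * (W * R ^ DIM('a) * min 1 (DIM('a) * r / R) * (W * r ^ DIM('a))) =
           s * W * (r powr (- \<sigma> - 1) * ((W * R ^ DIM('a)) * min 1 (DIM('a) / R * r)))"
          by (simp add: algebra_simps)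
        also have "ennreal \<dots> = ennreal (s * W) * (ennreal (r powr (- \<sigma> - 1) * ((W * R ^ DIM('a)) * min 1 (DIM('a) / R * r))) * indicator {0..} r)"
          using s W R True by (simp add: ennreal_mult)
        finally show ?thesis .
      next
        case False
        \<comment> \<open>For negative r no pair satisfies \<open>T\<close>; at \<open>r = 0\<close>
          the weight is 0 by the convention for \<open>powr\<close>.\<close>
        have "ennreal (s * r powr (- s - 1)) * indicator {w. T (fst w) (snd w)} (z, r) = 0" for z
        proof (cases "r = 0")
          case False
          with \<open>\<not> 0 < r\<close> have "\<not> T z r"
            unfolding T_def by (smt (verit) norm_ge_zero)
          then show ?thesis by (simp add: indicator_def)
        qed simp
        then show ?thesis by (simp only: nn_integral_const mult_zero_left zero_le)
      qed
    qed
    also have "\<dots> = ennreal (s * W) * (\<integral>\<^sup>+r. ennreal (r powr (- \<sigma> - 1) * ((W * R ^ DIM('a)) * min 1 (DIM('a) / R * r))) * indicator {0..} r \<partial>lborel)"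
      by (rule nn_integral_cmult) simp
    also have "\<dots> < \<infinity>"
      using nn_integral_layer_finite[OF \<sigma>, of "W * R ^ DIM('a)" "DIM('a) / R"] R
      by (simp add: ennreal_mult_less_top W_def)
    finally show ?thesis .
  qed
  then have "2 * (\<integral>\<^sup>+z. h z \<partial>(?L \<Otimes>\<^sub>M ?L)) < \<infinity>"
    by (simp add: ennreal_mult_less_top)
  finally show ?thesis by (simp add: s_def B_def)
qed

text \<open>The set where \<open>h\<close> jumps lies in the union of the jump sets of
  \<open>f\<close> and \<open>g\<close>. Stating the hypothesis on jumps alone makes the bound apply
  to sums of functions and to indicators of unions alike.\<close>

lemma jump_energy_subadditive:
  fixes f g h :: "'a::euclidean_space \<Rightarrow> real"
  assumes [measurable]: "f \<in> borel_measurable lebesgue" "g \<in> borel_measurable lebesgue"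
    and jump: "\<And>x y. h x \<noteq> h y \<Longrightarrow> f x \<noteq> f y \<or> g x \<noteq> g y"
  shows "jump_energy s h \<le> jump_energy s f + jump_energy s g"
proof -
  have [measurable]: "(\<lambda>z. indicator {(x, y). u x \<noteq> u y} z * ennreal (norm (fst z - snd z) powr - s))
      \<in> borel_measurable (lebesgue \<Otimes>\<^sub>M lebesgue)"
    if [measurable]: "u \<in> borel_measurable lebesgue" for u :: "'a \<Rightarrow> real"
    unfolding split_beta' by measurable
  have "jump_energy s f + jump_energy s g =
      (\<integral>\<^sup>+z. indicator {(x, y). f x \<noteq> f y} z * ennreal (norm (fst z - snd z) powr - s) +
        indicator {(x, y). g x \<noteq> g y} z * ennreal (norm (fst z - snd z) powr - s)
       \<partial>(lebesgue \<Otimes>\<^sub>M lebesgue))"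
    unfolding jump_energy_def by (rule nn_integral_add[symmetric]) simp_all
  moreover have "jump_energy s h \<le> \<dots>"
    unfolding jump_energy_def
    by (intro nn_integral_mono) (use jump in \<open>force simp: indicator_def\<close>)
  ultimately show ?thesis by simp
qed

section \<open>The L^p closure of the functions of finite jump energy\<close>

text \<open>The error is the p-th power of the distance, as an \<open>ennreal\<close> integral, so
  integrability and the p-th root enter only when passing to \<open>Lp_norm\<close>.\<close>

definition Lp_approximable :: "real \<Rightarrow> real \<Rightarrow> ('a::euclidean_space \<Rightarrow> real) \<Rightarrow> bool" where
  "Lp_approximable p s f \<longleftrightarrow> f \<in> borel_measurable lebesgue \<and>
    (\<forall>e>0. \<exists>g \<in> borel_measurable lebesgue. jump_energy s g < \<infinity> \<and>
      (\<integral>\<^sup>+x. ennreal (\<bar>g x - f x\<bar> powr p) \<partial>lebesgue) < ennreal e)"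

text \<open>A crude replacement for Minkowski's inequality, from |a + b| \<le> 2 max(|a|, |b|). The
  constant is harmless for closure under sums and limits.\<close>

lemma abs_add_powr_le:
  fixes a b p :: real
  assumes "0 \<le> p"
  shows "\<bar>a + b\<bar> powr p \<le> 2 powr p * (\<bar>a\<bar> powr p + \<bar>b\<bar> powr p)"
proof -
  have "\<bar>a + b\<bar> powr p \<le> (2 * max \<bar>a\<bar> \<bar>b\<bar>) powr p"
    using assms by (intro powr_mono2) auto
  also have "\<dots> = 2 powr p * max \<bar>a\<bar> \<bar>b\<bar> powr p"
    by (simp add: powr_mult)
  also have "max \<bar>a\<bar> \<bar>b\<bar> powr p \<le> \<bar>a\<bar> powr p + \<bar>b\<bar> powr p"
    by (simp add: max_def)
  finally show ?thesis by simp
qed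

lemma nn_integral_abs_add_powr_le:
  fixes f g :: "'a \<Rightarrow> real"
  assumes [measurable]: "f \<in> borel_measurable M" "g \<in> borel_measurable M" and p: "0 \<le> p"
  shows "(\<integral>\<^sup>+x. ennreal (\<bar>f x + g x\<bar> powr p) \<partial>M) \<le>
    ennreal (2 powr p) * ((\<integral>\<^sup>+x. ennreal (\<bar>f x\<bar> powr p) \<partial>M) + (\<integral>\<^sup>+x. ennreal (\<bar>g x\<bar> powr p) \<partial>M))"
proof -
  have "(\<integral>\<^sup>+x. ennreal (\<bar>f x + g x\<bar> powr p) \<partial>M) \<le>
      (\<integral>\<^sup>+x. ennreal (2 powr p) * (ennreal (\<bar>f x\<bar> powr p) + ennreal (\<bar>g x\<bar> powr p)) \<partial>M)"
    using abs_add_powr_le[OF p]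
    by (intro nn_integral_mono) (simp add: ennreal_plus[symmetric] ennreal_mult[symmetric] ennreal_leI
        del: ennreal_plus)
  also have "\<dots> = ennreal (2 powr p) * ((\<integral>\<^sup>+x. ennreal (\<bar>f x\<bar> powr p) \<partial>M) + (\<integral>\<^sup>+x. ennreal (\<bar>g x\<bar> powr p) \<partial>M))"
    by (simp add: nn_integral_cmult nn_integral_add)
  finally show ?thesis .
qed

lemma Lp_approximable_add:
  assumes p: "0 \<le> p" and f: "Lp_approximable p s f" and g: "Lp_approximable p s g"
  shows "Lp_approximable p s (\<lambda>x. f x + g x)"
  unfolding Lp_approximable_def
proof (intro conjI allI impI)
  have [measurable]: "f \<in> borel_measurable lebesgue" "g \<in> borel_measurable lebesgue"
    using f g by (auto simp: Lp_approximable_def)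
  show "(\<lambda>x. f x + g x) \<in> borel_measurable lebesgue" by measurable
  fix e :: real assume e: "0 < e"
  \<comment> \<open>Chosen so that \<open>2 powr p * (d + d) = e\<close>.\<close>
  define d where "d = e / (2 * 2 powr p)"
  have d: "0 < d" using e by (simp add: d_def)
  obtain u where [measurable]: "u \<in> borel_measurable lebesgue" and u: "jump_energy s u < \<infinity>"
    "(\<integral>\<^sup>+x. ennreal (\<bar>u x - f x\<bar> powr p) \<partial>lebesgue) < ennreal d"
    using f d unfolding Lp_approximable_def by blast
  obtain v where [measurable]: "v \<in> borel_measurable lebesgue" and v: "jump_energy s v < \<infinity>"
    "(\<integral>\<^sup>+x. ennreal (\<bar>v x - g x\<bar> powr p) \<partial>lebesgue) < ennreal d"
    using g d unfolding Lp_approximable_def by blast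
  show "\<exists>w \<in> borel_measurable lebesgue. jump_energy s w < \<infinity> \<and>
      (\<integral>\<^sup>+x. ennreal (\<bar>w x - (f x + g x)\<bar> powr p) \<partial>lebesgue) < ennreal e"
  proof (intro bexI conjI)
    have "jump_energy s (\<lambda>x. u x + v x) \<le> jump_energy s u + jump_energy s v"
      by (rule jump_energy_subadditive) auto
    then show "jump_energy s (\<lambda>x. u x + v x) < \<infinity>"
      using u(1) v(1) by (simp add: le_less_trans)
    have "(\<integral>\<^sup>+x. ennreal (\<bar>u x + v x - (f x + g x)\<bar> powr p) \<partial>lebesgue) =
        (\<integral>\<^sup>+x. ennreal (\<bar>(u x - f x) + (v x - g x)\<bar> powr p) \<partial>lebesgue)"
      by (simp add: algebra_simps)
    also have "\<dots> \<le> ennreal (2 powr p) * ((\<integral>\<^sup>+x. ennreal (\<bar>u x - f x\<bar> powr p) \<partial>lebesgue) +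
        (\<integral>\<^sup>+x. ennreal (\<bar>v x - g x\<bar> powr p) \<partial>lebesgue))"
      by (rule nn_integral_abs_add_powr_le[OF _ _ p]) auto
    also have "\<dots> < ennreal (2 powr p) * (ennreal d + ennreal d)"
      using u(2) v(2) by (intro ennreal_mult_strict_left_mono add_strict_mono) auto
    also have "\<dots> = ennreal (2 powr p * (d + d))"
      using d by (simp only: ennreal_plus ennreal_mult powr_ge_zero add_nonneg_nonneg less_imp_le)
    also have "2 powr p * (d + d) = e"
      by (simp add: d_def)
    finally show "(\<integral>\<^sup>+x. ennreal (\<bar>u x + v x - (f x + g x)\<bar> powr p) \<partial>lebesgue) < ennreal e" .
  qed simp
qed

lemma Lp_approximable_zero: "Lp_approximable p s (\<lambda>x. 0)"
  unfolding Lp_approximable_def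
proof (intro conjI allI impI)
  fix e :: real assume "0 < e"
  then show "\<exists>g \<in> borel_measurable lebesgue. jump_energy s g < \<infinity> \<and>
      (\<integral>\<^sup>+x. ennreal (\<bar>g x - 0\<bar> powr p) \<partial>lebesgue) < ennreal e"
    by (intro bexI[of _ "\<lambda>x. 0"]) (auto simp: jump_energy_def)
qed simp

text \<open>Multiplying by \<open>c \<noteq> 0\<close> leaves the jump set, hence the energy,
  unchanged and scales the error by \<open>\<bar>c\<bar> powr p\<close>; the case
  \<open>c = 0\<close> is the zero function.\<close>

lemma Lp_approximable_scale:
  assumes f: "Lp_approximable p s f"
  shows "Lp_approximable p s (\<lambda>x. f x * c)"
proof (cases "c = 0")
  case True
  then show ?thesis by (simp add: Lp_approximable_zero)
next
  case False
  show ?thesis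
    unfolding Lp_approximable_def
  proof (intro conjI allI impI)
    have [measurable]: "f \<in> borel_measurable lebesgue"
      using f by (auto simp: Lp_approximable_def)
    show "(\<lambda>x. f x * c) \<in> borel_measurable lebesgue" by measurable
    fix e :: real assume e: "0 < e"
    define d where "d = e / \<bar>c\<bar> powr p"
    have d: "0 < d" using e False by (simp add: d_def)
    obtain u where [measurable]: "u \<in> borel_measurable lebesgue" and u: "jump_energy s u < \<infinity>"
      "(\<integral>\<^sup>+x. ennreal (\<bar>u x - f x\<bar> powr p) \<partial>lebesgue) < ennreal d"
      using f d unfolding Lp_approximable_def by blast
    have "(\<integral>\<^sup>+x. ennreal (\<bar>u x * c - f x * c\<bar> powr p) \<partial>lebesgue) =
        (\<integral>\<^sup>+x. ennreal (\<bar>c\<bar> powr p) * ennreal (\<bar>u x - f x\<bar> powr p) \<partial>lebesgue)"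
    proof (intro nn_integral_cong)
      fix x
      have "u x * c - f x * c = c * (u x - f x)" by (simp add: algebra_simps)
      then show "ennreal (\<bar>u x * c - f x * c\<bar> powr p) = ennreal (\<bar>c\<bar> powr p) * ennreal (\<bar>u x - f x\<bar> powr p)"
        by (simp only: abs_mult powr_mult abs_ge_zero ennreal_mult powr_ge_zero)
    qed
    also have "\<dots> = ennreal (\<bar>c\<bar> powr p) * (\<integral>\<^sup>+x. ennreal (\<bar>u x - f x\<bar> powr p) \<partial>lebesgue)"
      by (simp add: nn_integral_cmult)
    also have "\<dots> < ennreal (\<bar>c\<bar> powr p) * ennreal d"
      using u(2) False by (intro ennreal_mult_strict_left_mono) auto
    also have "\<dots> = ennreal e"
      using False d by (simp add: ennreal_mult[symmetric] d_def)
    finally have "(\<integral>\<^sup>+x. ennreal (\<bar>u x * c - f x * c\<bar> powr p) \<partial>lebesgue) < ennreal e" .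
    moreover have "jump_energy s (\<lambda>x. u x * c) < \<infinity>"
      using u(1) False by (simp add: jump_energy_def)
    ultimately show "\<exists>g \<in> borel_measurable lebesgue. jump_energy s g < \<infinity> \<and>
      (\<integral>\<^sup>+x. ennreal (\<bar>g x - f x * c\<bar> powr p) \<partial>lebesgue) < ennreal e"
      by (intro bexI[of _ "\<lambda>x. u x * c"]) auto
  qed
qed

lemma Lp_approximable_sum:
  assumes p: "0 \<le> p" and f: "\<And>i. i \<in> I \<Longrightarrow> Lp_approximable p s (f i)"
  shows "Lp_approximable p s (\<lambda>x. \<Sum>i\<in>I. f i x)"
  using f
  by (induction I rule: infinite_finite_induct) (auto intro!: Lp_approximable_add Lp_approximable_zero p)

text \<open>A function of finite jump energy close to some \<open>F i\<close>, itself close to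
  \<open>f\<close>, is close to \<open>f\<close> up to the factor \<open>2 powr p\<close>.\<close>

lemma Lp_approximable_limit:
  assumes p: "0 \<le> p" and [measurable]: "f \<in> borel_measurable lebesgue"
    and F: "\<And>i. Lp_approximable p s (F i)"
    and lim: "(\<lambda>i. \<integral>\<^sup>+x. ennreal (\<bar>F i x - f x\<bar> powr p) \<partial>lebesgue) \<longlonglongrightarrow> 0"
  shows "Lp_approximable p s f"
  unfolding Lp_approximable_def
proof (intro conjI allI impI)
  have [measurable]: "F i \<in> borel_measurable lebesgue" for i
    using F by (auto simp: Lp_approximable_def)
  fix e :: real assume e: "0 < e"
  define d where "d = e / (2 * 2 powr p)"
  have d: "0 < d" using e by (simp add: d_def)
  obtain i where i: "(\<integral>\<^sup>+x. ennreal (\<bar>F i x - f x\<bar> powr p) \<partial>lebesgue) < ennreal d"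
    using order_tendstoD(2)[OF lim, of "ennreal d"] d by (auto simp: eventually_sequentially)
  obtain u where [measurable]: "u \<in> borel_measurable lebesgue" and u: "jump_energy s u < \<infinity>"
    "(\<integral>\<^sup>+x. ennreal (\<bar>u x - F i x\<bar> powr p) \<partial>lebesgue) < ennreal d"
    using F[of i] d unfolding Lp_approximable_def by blast
  have "(\<integral>\<^sup>+x. ennreal (\<bar>u x - f x\<bar> powr p) \<partial>lebesgue) =
      (\<integral>\<^sup>+x. ennreal (\<bar>(u x - F i x) + (F i x - f x)\<bar> powr p) \<partial>lebesgue)"
    by simp
  also have "\<dots> \<le> ennreal (2 powr p) * ((\<integral>\<^sup>+x. ennreal (\<bar>u x - F i x\<bar> powr p) \<partial>lebesgue) +
      (\<integral>\<^sup>+x. ennreal (\<bar>F i x - f x\<bar> powr p) \<partial>lebesgue))"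
    by (rule nn_integral_abs_add_powr_le[OF _ _ p]) auto
  also have "\<dots> < ennreal (2 powr p) * (ennreal d + ennreal d)"
    using u(2) i by (intro ennreal_mult_strict_left_mono add_strict_mono) auto
  also have "\<dots> = ennreal (2 powr p * (d + d))"
    using d by (simp only: ennreal_plus ennreal_mult powr_ge_zero add_nonneg_nonneg less_imp_le)
  also have "2 powr p * (d + d) = e"
    by (simp add: d_def)
  finally show "\<exists>g \<in> borel_measurable lebesgue. jump_energy s g < \<infinity> \<and>
      (\<integral>\<^sup>+x. ennreal (\<bar>g x - f x\<bar> powr p) \<partial>lebesgue) < ennreal e"
    using u(1) by (intro bexI[of _ u]) auto
qed simp

section \<open>Density: from unions of balls to all of L^p\<close>

text \<open>Two points separated by a union are separated by one of its members, so subadditivity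
  applies inductively. Openness supplies measurability.\<close>

lemma jump_energy_Union_balls:
  fixes C :: "'a::euclidean_space set set" and \<sigma> :: real
  assumes \<sigma>: "0 < \<sigma>" "\<sigma> < 1"
    and C: "finite C" "\<And>B. B \<in> C \<Longrightarrow> \<exists>c R. 0 < R \<and> B = ball c R"
  shows "jump_energy (DIM('a) + \<sigma>) (indicator (\<Union>C)) < \<infinity>"
  using C
proof (induction C rule: finite_induct)
  case empty
  then show ?case by (simp add: jump_energy_def)
next
  case (insert B C)
  obtain c R where B: "0 < R" "B = ball c R" using insert.prems by blast
  have "open (\<Union>C)" using insert.prems by (intro open_Union ballI) (metis insertCI open_ball)
  then have le: "jump_energy (DIM('a) + \<sigma>) (indicator (\<Union>(insert B C))) \<le>
      jump_energy (DIM('a) + \<sigma>) (indicator B) + jump_energy (DIM('a) + \<sigma>) (indicator (\<Union>C))"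
  proof (intro jump_energy_subadditive borel_measurable_indicator)
    fix x y
    assume "(indicator (\<Union>(insert B C)) x :: real) \<noteq> indicator (\<Union>(insert B C)) y"
    then show "(indicator B x :: real) \<noteq> indicator B y \<or> (indicator (\<Union>C) x :: real) \<noteq> indicator (\<Union>C) y"
      by (cases "x \<in> B"; cases "y \<in> B") (simp_all add: indicator_def)
  qed (auto simp: B)
  have "jump_energy (DIM('a) + \<sigma>) (indicator B) < \<infinity>"
    unfolding B(2) by (rule jump_energy_ball[OF \<sigma> B(1)])
  moreover have "jump_energy (DIM('a) + \<sigma>) (indicator (\<Union>C)) < \<infinity>"
    using insert.prems by (intro insert.IH) simp
  ultimately show ?case
    by (intro le_less_trans[OF le]) simp
qed

text \<open>By regularity E lies between a closed T and an open U with little measure in between.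
  Boundedness makes T compact, so finitely many balls inside U cover it; the indicator of their
  union differs from that of E only on \<open>E - T\<close> and \<open>U - E\<close>. The difference
  is 0 or \<plusminus>1, so the exponent p has no effect on it.\<close>

lemma Lp_approximable_indicator:
  fixes E :: "'a::euclidean_space set" and \<sigma> :: real
  assumes \<sigma>: "0 < \<sigma>" "\<sigma> < 1"
    and E [measurable]: "E \<in> sets lebesgue" and bdd: "bounded E"
  shows "Lp_approximable p (DIM('a) + \<sigma>) (indicator E)"
  unfolding Lp_approximable_def
proof (intro conjI allI impI)
  fix e :: real assume e: "0 < e"
  obtain T where T: "closed T" "T \<subseteq> E" "E - T \<in> lmeasurable" "emeasure lebesgue (E - T) < ennreal (e/2)"
    using sets_lebesgue_inner_closed[OF E, of "e/2"] e by auto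
  obtain U where U: "open U" "E \<subseteq> U" "U - E \<in> lmeasurable" "emeasure lebesgue (U - E) < ennreal (e/2)"
    using sets_lebesgue_outer_open[OF E, of "e/2"] e by auto
  have "compact T"
    using T(1) bounded_subset[OF bdd T(2)] by (simp add: compact_eq_bounded_closed)
  moreover define \<B> where "\<B> = {B. B \<subseteq> U \<and> (\<exists>c R. 0 < R \<and> B = ball c R)}"
  have "T \<subseteq> \<Union>\<B>"
  proof
    fix x assume "x \<in> T"
    then obtain R where "0 < R" "ball x R \<subseteq> U"
      using T U open_contains_ball by (metis subset_iff)
    then show "x \<in> \<Union>\<B>"
      by (intro UnionI[of "ball x R"]) (auto simp: \<B>_def)
  qed
  moreover have "\<And>B. B \<in> \<B> \<Longrightarrow> open B" by (auto simp: \<B>_def)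
  ultimately obtain C where C: "C \<subseteq> \<B>" "finite C" "T \<subseteq> \<Union>C"
    by (meson compactE)
  define g :: "'a \<Rightarrow> real" where "g = indicator (\<Union>C)"
  have "open (\<Union>C)" using C by (intro open_Union) (auto simp: \<B>_def)
  then have "g \<in> borel_measurable lebesgue"
    unfolding g_def by (intro borel_measurable_indicator) auto
  moreover have "jump_energy (DIM('a) + \<sigma>) g < \<infinity>"
    unfolding g_def using C(1) by (intro jump_energy_Union_balls \<sigma> C(2)) (auto simp: \<B>_def)
  moreover have "(\<integral>\<^sup>+x. ennreal (\<bar>g x - indicator E x\<bar> powr p) \<partial>lebesgue) < ennreal e"
  proof -
    have CU: "\<Union>C \<subseteq> U" using C by (auto simp: \<B>_def)
    have "(\<integral>\<^sup>+x. ennreal (\<bar>g x - indicator E x\<bar> powr p) \<partial>lebesgue) \<le>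
        (\<integral>\<^sup>+x. indicator (E - T) x + indicator (U - E) x \<partial>lebesgue)"
    proof (intro nn_integral_mono)
      fix x
      consider "x \<in> T" | "x \<in> E - T" | "x \<in> U - E" | "x \<notin> U"
        using T(2) U(2) by blast
      then show "ennreal (\<bar>g x - indicator E x\<bar> powr p) \<le> indicator (E - T) x + indicator (U - E) x"
      proof cases
        case 1
        then have "x \<in> \<Union>C" "x \<in> E" using C(3) T(2) by blast+
        then show ?thesis by (simp only: g_def indicator_simps) simp
      next
        case 4
        then have "x \<notin> \<Union>C" "x \<notin> E" using CU U(2) by blast+
        then show ?thesis by (simp only: g_def indicator_simps) simp
      qed (auto simp: g_def indicator_def)
    qed
    also have "\<dots> = emeasure lebesgue (E - T) + emeasure lebesgue (U - E)"
      using T U by (subst nn_integral_add) auto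
    also have "\<dots> < ennreal (e/2) + ennreal (e/2)"
      using T U by (intro add_strict_mono) auto
    also have "\<dots> = ennreal e"
      using e by (simp add: ennreal_plus[symmetric] del: ennreal_plus)
    finally show ?thesis .
  qed
  ultimately show "\<exists>g \<in> borel_measurable lebesgue. jump_energy (DIM('a) + \<sigma>) g < \<infinity> \<and>
      (\<integral>\<^sup>+x. ennreal (\<bar>g x - indicator E x\<bar> powr p) \<partial>lebesgue) < ennreal e"
    by blast
qed simp

text \<open>Decompose f into its level sets. The level set of 0 is unbounded, but its coefficient is
  0; the others lie in the bounded support.\<close>

lemma Lp_approximable_simple_function:
  fixes f :: "'a::euclidean_space \<Rightarrow> real" and p \<sigma> :: real
  assumes p: "0 \<le> p" and \<sigma>: "0 < \<sigma>" "\<sigma> < 1"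
    and f: "simple_function lebesgue f" and bdd: "bounded {x. f x \<noteq> 0}"
  shows "Lp_approximable p (DIM('a) + \<sigma>) f"
proof -
  have "Lp_approximable p (DIM('a) + \<sigma>) (\<lambda>x. \<Sum>y\<in>range f. indicator (f -` {y}) x * y)"
  proof (rule Lp_approximable_sum[OF p])
    fix y
    show "Lp_approximable p (DIM('a) + \<sigma>) (\<lambda>x. indicator (f -` {y}) x * y)"
    proof (cases "y = 0")
      case True
      then show ?thesis by (simp add: Lp_approximable_zero)
    next
      case False
      then have "bounded (f -` {y})" by (intro bounded_subset[OF bdd]) auto
      moreover have "f -` {y} \<in> sets lebesgue"
        using simple_functionD(2)[OF f, of "{y}"] by simp
      ultimately show ?thesis
        by (intro Lp_approximable_scale Lp_approximable_indicator \<sigma>)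
    qed
  qed
  moreover have "f = (\<lambda>x. \<Sum>y\<in>range f. indicator (f -` {y}) x * y)"
    by (rule ext, subst simple_function_indicator_representation_banach[OF f]) simp_all
  ultimately show ?thesis by simp
qed

text \<open>Simple functions dominated by 2|u|, cut off to balls of growing radius to get bounded
  support, converge to u in L^p by dominated convergence.\<close>

lemma Lp_approximable_Lp:
  fixes u :: "'a::euclidean_space \<Rightarrow> real" and p \<sigma> :: real
  assumes p: "0 < p" and \<sigma>: "0 < \<sigma>" "\<sigma> < 1"
    and u [measurable]: "u \<in> borel_measurable lebesgue"
    and int: "integrable lebesgue (\<lambda>x. \<bar>u x\<bar> powr p)"
  shows "Lp_approximable p (DIM('a) + \<sigma>) u"
proof -
  obtain F where F: "\<And>i. simple_function lebesgue (F i)" "\<And>x. (\<lambda>i. F i x) \<longlonglongrightarrow> u x"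
    "\<And>i x. \<bar>F i x\<bar> \<le> 2 * \<bar>u x\<bar>"
    using borel_measurable_implies_sequence_metric[OF u, of 0] by (auto simp: dist_real_def)
  define G where "G i x = F i x * indicator (cball 0 (real i)) x" for i x
  have G: "simple_function lebesgue (G i)" for i
    unfolding G_def by (intro simple_function_mult F simple_function_indicator) auto
  have [measurable]: "G i \<in> borel_measurable lebesgue" for i
    by (rule borel_measurable_simple_function[OF G])
  have lim: "(\<lambda>i. G i x) \<longlonglongrightarrow> u x" for x
  proof (rule Lim_transform_eventually[OF F(2)])
    obtain n :: nat where "norm x \<le> real n" using real_arch_simple by blast
    then show "\<forall>\<^sub>F i in sequentially. F i x = G i x"
      by (intro eventually_sequentiallyI[of n]) (auto simp: G_def)
  qed
  have "(\<lambda>i. \<integral>\<^sup>+x. ennreal (\<bar>G i x - u x\<bar> powr p) \<partial>lebesgue) \<longlonglongrightarrow>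
      (\<integral>\<^sup>+x. 0 \<partial>(lebesgue :: 'a measure))"
  \<comment> \<open>The 3 in the majorant is 2 + 1, from
    \<open>\<bar>G i x\<bar> \<le> 2 * \<bar>u x\<bar>\<close> and the subtracted
    \<open>u x\<close>.\<close>
  proof (rule nn_integral_dominated_convergence[where w = "\<lambda>x. ennreal (3 powr p * \<bar>u x\<bar> powr p)"])
    show "AE x in lebesgue. (\<lambda>i. ennreal (\<bar>G i x - u x\<bar> powr p)) \<longlonglongrightarrow> 0"
    proof (intro AE_I2)
      fix x
      have "(\<lambda>i. ennreal (\<bar>G i x - u x\<bar> powr p)) \<longlonglongrightarrow> ennreal (\<bar>u x - u x\<bar> powr p)"
        \<comment> \<open>The base tends to 0, where continuity of \<open>powr\<close> needs the
          positive exponent.\<close>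
        using p by (intro tendsto_ennrealI tendsto_powr2 tendsto_intros lim) auto
      then show "(\<lambda>i. ennreal (\<bar>G i x - u x\<bar> powr p)) \<longlonglongrightarrow> 0"
        by simp
    qed
    show "AE x in lebesgue. ennreal (\<bar>G i x - u x\<bar> powr p) \<le> ennreal (3 powr p * \<bar>u x\<bar> powr p)" for i
    proof (intro AE_I2 ennreal_leI)
      fix x
      have "\<bar>G i x\<bar> \<le> 2 * \<bar>u x\<bar>"
        using F(3)[of i x] by (auto simp: G_def indicator_def)
      then have "\<bar>G i x - u x\<bar> powr p \<le> (3 * \<bar>u x\<bar>) powr p"
        using p by (intro powr_mono2) auto
      then show "\<bar>G i x - u x\<bar> powr p \<le> 3 powr p * \<bar>u x\<bar> powr p"
        by (simp add: powr_mult)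
    qed
    show "(\<integral>\<^sup>+x. ennreal (3 powr p * \<bar>u x\<bar> powr p) \<partial>lebesgue) < \<infinity>"
      using int by (simp add: ennreal_mult nn_integral_cmult ennreal_mult_less_top integrable_iff_bounded)
  qed simp_all
  moreover have "Lp_approximable p (DIM('a) + \<sigma>) (G i)" for i
  proof (rule Lp_approximable_simple_function[OF _ \<sigma> G])
    show "bounded {x. G i x \<noteq> 0}"
      by (rule bounded_subset[OF bounded_cball[of 0 "real i"]]) (auto simp: G_def indicator_def)
  qed (use p in simp)
  ultimately show ?thesis
    using p by (intro Lp_approximable_limit[of _ u _ G]) auto
qed

section \<open>Consequences for \<open>Phi\<close> and \<open>Lp_norm\<close>\<close>

text \<open>A quotient exceeding \<open>l > 0\<close> has a nonzero numerator, whatever its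
  denominator. The exponents agree because \<open>DIM(real ^ 'n) = CARD('n)\<close>.\<close>

lemma Phi_le_jump_energy:
  fixes u :: "real ^ 'n \<Rightarrow> real"
  assumes "0 < l"
  shows "Phi p \<gamma> l u \<le> ennreal (l powr p) * jump_energy (real DIM(real ^ 'n) + - \<gamma>) u"
  unfolding Phi_def jump_energy_def
proof (intro mult_left_mono nn_integral_mono)
  fix z :: "(real ^ 'n) \<times> (real ^ 'n)"
  have "z \<in> {(x, y). u x \<noteq> u y}" if "z \<in> Phi_set p \<gamma> l u"
    using that assms by (auto simp: Phi_set_def)
  then show "ennreal (norm (fst z - snd z) powr (- real CARD('n) + \<gamma>)) * indicator (Phi_set p \<gamma> l u) z \<le>
      indicator {(x, y). u x \<noteq> u y} z * ennreal (norm (fst z - snd z) powr - (real DIM(real ^ 'n) + - \<gamma>))"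
    by (auto simp: indicator_def)
qed simp

lemma Lp_norm_nonneg: "0 \<le> Lp_norm p u"
  by (simp add: Lp_norm_def)

lemma Lp_jump_dense:
  fixes u :: "real ^ 'n \<Rightarrow> real"
  assumes p: "1 \<le> p" and \<gamma>: "-1 < \<gamma>" "\<gamma> < 0" and u: "u \<in> Lp p" and e: "0 < e"
  shows "\<exists>g \<in> Lp p. Lp_norm p (\<lambda>x. g x - u x) < e \<and> jump_energy (real DIM(real ^ 'n) + - \<gamma>) g < \<infinity>"
proof -
  have [measurable]: "u \<in> borel_measurable lebesgue" and int: "integrable lebesgue (\<lambda>x. \<bar>u x\<bar> powr p)"
    using u by (auto simp: Lp_def)
  have "Lp_approximable p (real DIM(real ^ 'n) + - \<gamma>) u"
    using p \<gamma> int by (intro Lp_approximable_Lp) auto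
  \<comment> \<open>Approximability controls the p-th power of the norm, so it is invoked with
    \<open>e powr p\<close>.\<close>
  moreover have "0 < e powr p" using e by simp
  ultimately obtain g where [measurable]: "g \<in> borel_measurable lebesgue"
    and g: "jump_energy (real DIM(real ^ 'n) + - \<gamma>) g < \<infinity>"
      "(\<integral>\<^sup>+x. ennreal (\<bar>g x - u x\<bar> powr p) \<partial>lebesgue) < ennreal (e powr p)"
    unfolding Lp_approximable_def by blast
  have "(\<integral>\<^sup>+x. ennreal (\<bar>g x\<bar> powr p) \<partial>lebesgue) = (\<integral>\<^sup>+x. ennreal (\<bar>(g x - u x) + u x\<bar> powr p) \<partial>lebesgue)"
    by simp
  also have "\<dots> \<le> ennreal (2 powr p) * ((\<integral>\<^sup>+x. ennreal (\<bar>g x - u x\<bar> powr p) \<partial>lebesgue) +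
      (\<integral>\<^sup>+x. ennreal (\<bar>u x\<bar> powr p) \<partial>lebesgue))"
    using p by (intro nn_integral_abs_add_powr_le) auto
  also have "\<dots> < \<infinity>"
    using order.strict_trans[OF g(2) ennreal_less_top] int
    by (simp add: ennreal_mult_less_top integrable_iff_bounded)
  finally have "g \<in> Lp p" by (simp add: Lp_def integrable_iff_bounded)
  moreover have "Lp_norm p (\<lambda>x. g x - u x) < e"
  proof -
    have "integrable lebesgue (\<lambda>x. \<bar>g x - u x\<bar> powr p)"
      using order.strict_trans[OF g(2) ennreal_less_top] by (simp add: integrable_iff_bounded)
    then have "ennreal (\<integral>x. \<bar>g x - u x\<bar> powr p \<partial>lebesgue) < ennreal (e powr p)"
      using g(2) by (simp add: nn_integral_eq_integral)
    then have "(\<integral>x. \<bar>g x - u x\<bar> powr p \<partial>lebesgue) < e powr p"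
      by (simp add: ennreal_less_iff)
    then have "(\<integral>x. \<bar>g x - u x\<bar> powr p \<partial>lebesgue) powr (1 / p) < (e powr p) powr (1 / p)"
      using p by (intro powr_less_mono2) auto
    then show ?thesis
      using p e by (simp add: Lp_norm_def powr_powr)
  qed
  ultimately show ?thesis using g(1) by blast
qed

section \<open>The recovery family, built from near-minimizers\<close>

theorem theorem8p3:
  fixes p \<gamma> :: real
  assumes "1 \<le> p" and "-1 < \<gamma>" and "\<gamma> < 0"
  shows "Gamma_converges_Lp p
    (Phi p \<gamma> :: real \<Rightarrow> (real ^ 'n::finite \<Rightarrow> real) \<Rightarrow> ennreal) (\<lambda>u. 0)"
  unfolding Gamma_converges_Lp_def
proof (intro ballI conjI allI impI)
  fix u :: "real ^ 'n \<Rightarrow> real"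
  assume u: "u \<in> Lp p"
  \<comment> \<open>Adding the distance to \<open>u\<close> lets a single minimization make both the
    distance and \<open>Phi\<close> small.\<close>
  define J where "J l f = ennreal (Lp_norm p (\<lambda>x. f x - u x)) + Phi p \<gamma> l f" for l f
  \<comment> \<open>One fixed \<open>g\<close> of finite jump energy within \<open>e / 2\<close> of
    \<open>u\<close> serves for all small l, since \<open>Phi\<close> at \<open>g\<close> is at most
    \<open>l powr p\<close> times a constant.\<close>
  have J_small: "\<forall>\<^sub>F l in at_right 0. \<exists>f\<in>Lp p. J l f < ennreal e" if e: "0 < e" for e
  proof -
    obtain g where g: "g \<in> Lp p" "Lp_norm p (\<lambda>x. g x - u x) < e / 2"
      "jump_energy (real DIM(real ^ 'n) + - \<gamma>) g < \<infinity>"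
      using Lp_jump_dense[OF assms u, of "e / 2"] e by auto
    then obtain C where C: "jump_energy (real DIM(real ^ 'n) + - \<gamma>) g = ennreal C" "0 \<le> C"
      by (cases "jump_energy (real DIM(real ^ 'n) + - \<gamma>) g") auto
    have "((\<lambda>l. l powr p * C) \<longlongrightarrow> 0 powr p * C) (at_right 0)"
      using assms by (intro tendsto_intros tendsto_powr2) (auto simp: eventually_at_right_less eventually_at_filter)
    then have "\<forall>\<^sub>F l in at_right 0. l powr p * C < e / 2"
      using order_tendstoD(2)[of _ "0 powr p * C" _ "e / 2"] e by simp
    then show ?thesis
      using eventually_at_right_less[of 0]
    proof eventually_elim
      case (elim l)
      have "J l g \<le> ennreal (Lp_norm p (\<lambda>x. g x - u x)) + ennreal (l powr p) * ennreal C"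
        unfolding J_def using Phi_le_jump_energy[OF elim(2), of p \<gamma> g] C by (intro add_left_mono) simp
      also have "\<dots> = ennreal (Lp_norm p (\<lambda>x. g x - u x) + l powr p * C)"
        using C by (simp add: ennreal_mult Lp_norm_nonneg)
      also have "\<dots> < ennreal e"
        using elim g(2) C e by (intro ennreal_lessI) auto
      finally show ?case using g(1) by blast
    qed
  qed
  \<comment> \<open>The infimum need not be attained, so a slack is allowed; taking it to be
    \<open>l\<close> makes it vanish in the limit. If the infimum is infinite, \<open>u\<close>
    itself serves. Minimizing for each l separately replaces a diagonal choice of
    approximants.\<close>
  have "\<exists>f\<in>Lp p. J l f \<le> (INF f\<in>Lp p. J l f) + ennreal l" if "0 < l" for l
  proof (cases "(INF f\<in>Lp p. J l f) = \<infinity>")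
    case True
    then show ?thesis using u by auto
  next
    case False
    then have "(INF f\<in>Lp p. J l f) < (INF f\<in>Lp p. J l f) + ennreal l"
      using that by (simp add: less_top ennreal_add_left_cancel_less)
    then show ?thesis unfolding INF_less_iff by (meson less_imp_le)
  qed
  then obtain w where w: "\<And>l. 0 < l \<Longrightarrow> w l \<in> Lp p"
      "\<And>l. 0 < l \<Longrightarrow> J l (w l) \<le> (INF f\<in>Lp p. J l f) + ennreal l"
    by metis
  have lim: "((\<lambda>l. J l (w l)) \<longlongrightarrow> 0) (at_right 0)"
  proof (rule order_tendstoI)
    fix a :: ennreal assume "0 < a"
    \<comment> \<open>One e bounds the infimum, by \<open>J_small\<close>, the other the slack
      \<open>l\<close>.\<close>
    then obtain e where e: "0 < e" "ennreal e + ennreal e \<le> a"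
    proof (cases a)
      case (real r)
      then show ?thesis
        using that[of "r / 2"] \<open>0 < a\<close> by (simp add: ennreal_plus[symmetric] del: ennreal_plus)
    next
      case top
      then show ?thesis using that[of 1] by auto
    qed
    have "\<forall>\<^sub>F l in at_right 0. l < e"
      using e(1) by (intro eventually_at_rightI[of 0 e]) auto
    with J_small[OF e(1)] eventually_at_right_less[of 0]
    show "\<forall>\<^sub>F l in at_right 0. J l (w l) < a"
    proof (eventually_elim)
      case (elim l)
      then have "J l (w l) \<le> (INF f\<in>Lp p. J l f) + ennreal l" by (intro w) simp
      also have "\<dots> < ennreal e + ennreal e"
        using elim e(1) by (intro add_strict_mono) (auto simp: INF_less_iff ennreal_lessI)
      also have "\<dots> \<le> a" using e by simp
      finally show ?case .
    qed
  qed simp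
  show "\<exists>w. (\<forall>l>0. w l \<in> Lp p) \<and> Lp_tendsto p w u \<and> Limsup (at_right 0) (\<lambda>l. Phi p \<gamma> l (w l)) \<le> 0"
  proof (intro exI conjI allI impI)
    show "w l \<in> Lp p" if "0 < l" for l by (rule w(1)[OF that])
    have "((\<lambda>l. ennreal (Lp_norm p (\<lambda>x. w l x - u x))) \<longlongrightarrow> ennreal 0) (at_right 0)"
      unfolding ennreal_0
      \<comment> \<open>Each of the two summands of \<open>J\<close> is nonnegative and hence at
        most \<open>J\<close>.\<close>
      by (rule tendsto_sandwich[of "\<lambda>l. 0", OF _ _ tendsto_const lim]) (simp_all add: J_def)
    then show "Lp_tendsto p w u"
      unfolding Lp_tendsto_def by (rule tendsto_ennrealD) (auto simp: Lp_norm_nonneg)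
    have "Limsup (at_right 0) (\<lambda>l. Phi p \<gamma> l (w l)) \<le> Limsup (at_right 0) (\<lambda>l. J l (w l))"
      by (intro Limsup_mono) (simp add: J_def)
    also have "\<dots> = 0"
      by (rule lim_imp_Limsup[OF _ lim]) simp
    finally show "Limsup (at_right 0) (\<lambda>l. Phi p \<gamma> l (w l)) \<le> 0" .
  qed
\<comment> \<open>What remains is the lower bound, nonnegativity of a \<open>Liminf\<close> in
  \<open>ennreal\<close>.\<close>
qed simp

end
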